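(* Let $L\ge 0$ be an integer, let $\alpha>0$, and let $g\in\mathcal G_L$. Then $$\mathbb E_{\mathrm{Plan}}^{\alpha}[g]=\lim_{N\to\infty}\mathbb E_{\mathrm{Me},N,N}^{\alpha/N^2}[g],$$ where $\mathbb E_{\mathrm{Plan}}^{\alpha}$ denotes expectation with respect to the Poissonized Plancherel measure with parameter $\alpha$, and $\mathbb E_{\mathrm{Me},N,N}^{\alpha/N^2}$ denotes expectation with respect to the Meixner ensemble $\mathbb P_{\mathrm{Me},M,N}^{q}$ on $\Omega_M$ with $M=N$ and $q=\alpha/N^2$ (for $N$ large enough that $N\ge L$ and $\alpha/N^2<1$).
   Context: $\mathbb N=\{0,1,2,\dots\}$. $\mathcal P$ is the set of all partitions $\lambda=(\lambda_1\ge\lambda_2\ge\dots)$, $\lambda_i\in\mathbb N$, $\sum_j\lambda_j<\infty$; $\mathcal P^{(N)}$ is the set of partitions with $\sum_j\lambda_j=N$. $f^\lambda$ is the number of standard Young tableaux of shape $\lambda$. Plancherel measure: $\mathbb P_{\mathrm{Plan},N}[\{\lambda\}]=(f^\lambda)^2/N!$ for $\lambda\in\mathcal P^{(N)}$ (and $0$ for $\lambda\notin\mathcal P^{(N)}$). Poissonized Plancherel measure on $\mathcal P$: $\mathbb P_{\mathrm{Plan}}^\alpha[\{\lambda\}]=e^{-\alpha}\sum_{N=0}^\infty \mathbb P_{\mathrm{Plan},N}[\{\lambda\}]\frac{\alpha^N}{N!}$. The class $\mathcal G_L$: let $f:\mathbb Z\to\mathbb C$ be bounded with $f(n)=1$ for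 $n<0$. The function $g:\mathcal P\to\mathbb C$ generated by $f$ (for the given integer $L\ge0$) is $g(\lambda)=\prod_{i=1}^\infty f(\lambda_i+L-i)$. $\mathcal G_L$ is the set of all such $g$. $\Omega_M=\{\lambda\in\mathbb N^M:\lambda_1\ge\dots\ge\lambda_M\}$, identified with the partitions having at most $M$ nonzero parts; for $M\ge L$ and $\lambda\in\Omega_M$, $g(\lambda)=\prod_{i=1}^M f(\lambda_i+L-i)$. $V_M(\lambda)=\prod_{1\le i<j\le M}(\lambda_i-\lambda_j+j-i)$. For $q\in(0,1)$ and $N\ge M$ the Meixner ensemble is the probability measure on $\Omega_M$ $$\mathbb P_{\mathrm{Me},M,N}^q[\{\lambda\}]=(1-q)^{MN}\prod_{j=0}^{M-1}\frac{(N-M)!}{j!(N-M+j)!}\;V_M(\lambda)^2\prod_{i=1}^M\binom{\lambda_i+N-i}{\lambda_i+M-i}q^{\lambda_i}.$$ *)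

theory Defs
  imports "HOL-Analysis.Analysis"
begin

text \<open>
  All indices are shifted down by one with respect to the usual convention: the parts
  \<open>\<lambda>\<^sub>1 \<ge> \<lambda>\<^sub>2 \<ge> \<dots>\<close> of a partition are the values \<open>l 0 \<ge> l 1 \<ge> \<dots>\<close>
  of a function, so \<open>\<lambda>\<^sub>i\<close> is \<open>l (i - 1)\<close>. Hence \<open>\<lambda>\<^sub>i + L - i\<close> becomes
  \<open>l i + L - (i + 1)\<close>, for \<open>i = 0, 1, \<dots>\<close>.
\<close>

definition parts :: "(nat \<Rightarrow> nat) set" where
  "parts = {l. antimono l \<and> finite {i. l i \<noteq> 0}}"

definition psize :: "(nat \<Rightarrow> nat) \<Rightarrow> nat" where
  "psize l = (\<Sum>i | l i \<noteq> 0. l i)"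

definition parts_of :: "nat \<Rightarrow> (nat \<Rightarrow> nat) set" where
  "parts_of N = {l \<in> parts. psize l = N}"

text \<open>\<open>\<Omega>\<^sub>M\<close>, where a vector in \<open>\<nat>\<^sup>M\<close> is extended by zeros.\<close>

definition parts_upto :: "nat \<Rightarrow> (nat \<Rightarrow> nat) set" where
  "parts_upto M = {l \<in> parts. \<forall>i\<ge>M. l i = 0}"

definition cells :: "(nat \<Rightarrow> nat) \<Rightarrow> (nat \<times> nat) set" where
  "cells l = {(i, j). j < l i}"

text \<open>Fillings are restricted to be \<^const>\<open>extensional\<close> so that each one is counted once.\<close>

definition standard_tableaux :: "(nat \<Rightarrow> nat) \<Rightarrow> (nat \<times> nat \<Rightarrow> nat) set" where
  "standard_tableaux l =
     {T \<in> extensional (cells l).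
        bij_betw T (cells l) {1..psize l} \<and>
        (\<forall>i j. (i, Suc j) \<in> cells l \<longrightarrow> T (i, j) < T (i, Suc j)) \<and>
        (\<forall>i j. (Suc i, j) \<in> cells l \<longrightarrow> T (i, j) < T (Suc i, j))}"

definition num_syt :: "(nat \<Rightarrow> nat) \<Rightarrow> nat" where
  "num_syt l = card (standard_tableaux l)"

definition plancherel_mass :: "nat \<Rightarrow> (nat \<Rightarrow> nat) \<Rightarrow> real" where
  "plancherel_mass N l = (if l \<in> parts_of N then (real (num_syt l))\<^sup>2 / fact N else 0)"

definition poisson_plancherel_mass :: "real \<Rightarrow> (nat \<Rightarrow> nat) \<Rightarrow> real" where
  "poisson_plancherel_mass \<alpha> l =
     exp (- \<alpha>) * (\<Sum>N. plancherel_mass N l * (\<alpha> ^ N / fact N))"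

definition poisson_plancherel :: "real \<Rightarrow> (nat \<Rightarrow> nat) measure" where
  "poisson_plancherel \<alpha> = point_measure parts (\<lambda>l. ennreal (poisson_plancherel_mass \<alpha> l))"

definition vandermonde_parts :: "nat \<Rightarrow> (nat \<Rightarrow> nat) \<Rightarrow> real" where
  "vandermonde_parts M l =
     (\<Prod>(i, j) \<in> {(i, j). i < j \<and> j < M}. real (l i) - real (l j) + real j - real i)"

text \<open>
  Meant for \<open>M \<le> N\<close> and \<open>0 < q < 1\<close>; then none of the subtractions on \<^typ>\<open>nat\<close> truncates.
\<close>

definition meixner_mass :: "nat \<Rightarrow> nat \<Rightarrow> real \<Rightarrow> (nat \<Rightarrow> nat) \<Rightarrow> real" where
  "meixner_mass M N q l =
     (1 - q) ^ (M * N) *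
     (\<Prod>j<M. fact (N - M) / (fact j * fact (N - M + j))) *
     (vandermonde_parts M l)\<^sup>2 *
     (\<Prod>i<M. real ((l i + (N - Suc i)) choose (l i + (M - Suc i))) * q ^ l i)"

definition meixner :: "nat \<Rightarrow> nat \<Rightarrow> real \<Rightarrow> (nat \<Rightarrow> nat) measure" where
  "meixner M N q = point_measure (parts_upto M) (\<lambda>l. ennreal (meixner_mass M N q l))"

text \<open>
  The class \<open>\<G>\<^sub>L\<close>. Its members are functions on \<^const>\<open>parts\<close>; their values elsewhere are
  left unconstrained. For \<open>l \<in> parts\<close> all but finitely many factors are 1.
\<close>

definition gen_class :: "nat \<Rightarrow> ((nat \<Rightarrow> nat) \<Rightarrow> complex) set" where
  "gen_class L =
     {g. \<exists>f :: int \<Rightarrow> complex. bounded (range f) \<and> (\<forall>n<0. f n = 1) \<and>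
           (\<forall>l\<in>parts. g l = (\<Prod>i. f (int (l i) + int L - int (Suc i))))}"

lemma prodinf_parts_upto:
  fixes f :: "int \<Rightarrow> complex"
  assumes "\<forall>n<0. f n = 1" and "l \<in> parts_upto M" and "L \<le> M"
  shows "(\<Prod>i. f (int (l i) + int L - int (Suc i))) =
         (\<Prod>i<M. f (int (l i) + int L - int (Suc i)))"
proof (rule prodinf_finite)
  fix i assume "i \<notin> {..<M}"
  then have "l i = 0" and "L \<le> i"
    using assms by (auto simp: parts_upto_def)
  then show "f (int (l i) + int L - int (Suc i)) = 1"
    using assms(1) by simp
qed simp

end

theory Submission
  imports Defs
begin

text \<open>
  Write \<open>x\<^sub>i = l i - i\<close>, and let \<open>V\<close> be the Vandermonde product of the first \<open>M\<close> of the
  \<open>x\<^sub>i\<close>. Lagrange interpolation expresses the sum of \<open>(x\<^sub>i + c) V(x + t e\<^sub>i)\<close> over \<open>i\<close> as a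
  multiple of \<open>V(x)\<close>. For \<open>t = -1\<close> this matches the recursion of the number of standard tableaux
  under removal of a corner and gives Frobenius' formula for it. Combined with the case \<open>t = 1\<close>
  (adding a box), it gives a two-term recursion for the sum of \<open>V\<^sup>2\<close> over the partitions of \<open>n\<close>
  with at most \<open>M\<close> parts, and so the exact Meixner probability of \<open>{|\<lambda>| = n}\<close>, a negative
  binomial weight.

  Frobenius' formula yields convergence of the masses partition by partition. On the partitions of
  \<open>n\<close> a function in the class is at most exponential in \<open>n\<close>, whereas the negative binomial
  weights decay geometrically at a rate that tends to \<open>0\<close> as \<open>N\<close> grows; so the sums over \<open>n\<close>
  converge by Tannery's theorem.
\<close>

section \<open>Shifting a variable of a Vandermonde product\<close>

text \<open>The factor by which the Vandermonde product of the points in \<open>S\<close> changes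
  when \<open>x i\<close> is replaced by \<open>x i + t\<close>; see
  \<open>vdm_shift\<close>.\<close>

definition shift_ratio :: "nat set \<Rightarrow> (nat \<Rightarrow> real) \<Rightarrow> real \<Rightarrow> nat \<Rightarrow> real" where
  "shift_ratio S x t i = (\<Prod>j\<in>S - {i}. 1 + t / (x i - x j))"

lemma shift_ratio_insert:
  assumes "finite S" "k \<notin> S"
  shows "i \<in> S \<Longrightarrow> shift_ratio (insert k S) x t i = shift_ratio S x t i * (1 + t / (x i - x k))"
    and "shift_ratio (insert k S) x t k = (\<Prod>j\<in>S. 1 + t / (x k - x j))"
proof -
  assume "i \<in> S"
  then have "insert k S - {i} = insert k (S - {i})" "k \<notin> S - {i}" using assms by auto
  then show "shift_ratio (insert k S) x t i = shift_ratio S x t i * (1 + t / (x i - x k))"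
    unfolding shift_ratio_def using assms by simp
next
  show "shift_ratio (insert k S) x t k = (\<Prod>j\<in>S. 1 + t / (x k - x j))"
    unfolding shift_ratio_def using assms by simp
qed

lemma partial_fractions_two:
  fixes a t x y z :: real
  assumes "z \<noteq> x" "z \<noteq> y" "x \<noteq> y"
  shows "a / (z - x) * (1 + t / (z - y)) =
    a * (1 + t / (x - y)) / (z - x) + t / (z - y) * (a / (y - x))"
proof -
  define p q where "p = z - x" and "q = z - y"
  have *: "z - x = p" "z - y = q" "x - y = q - p" "y - x = -(q - p)" by (auto simp: p_def q_def)
  have "p \<noteq> 0" "q \<noteq> 0" "q - p \<noteq> 0" using assms by (auto simp: p_def q_def)
  then show ?thesis unfolding * by (simp add: divide_simps del: minus_diff_eq) (simp add: algebra_simps)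
qed

text \<open>As a function of \<open>z\<close> the product tends to 1 at infinity and has simple
  poles at the \<open>x i\<close> with residues \<open>t * shift_ratio S x t i\<close>. The
  induction keeps \<open>z\<close> general because the residue at a new point \<open>x k\<close>
  comes from the product over \<open>S\<close> at \<open>z = x k\<close>.\<close>

lemma prod_partial_fractions:
  assumes "finite S" "inj_on x S" "z \<notin> x ` S"
  shows "(\<Prod>j\<in>S. 1 + t / (z - x j)) = 1 + (\<Sum>i\<in>S. t * shift_ratio S x t i / (z - x i))"
  using assms
proof (induction S arbitrary: z rule: finite_induct)
  case empty
  then show ?case by simp
next
  case (insert k S)
  define a where "a i = t * shift_ratio S x t i" for i
  have zk: "z \<noteq> x k" and zi: "\<And>i. i \<in> S \<Longrightarrow> z \<noteq> x i" and ki: "\<And>i. i \<in> S \<Longrightarrow> x k \<noteq> x i"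
    using insert.prems insert.hyps by (auto simp: inj_on_def)
  have 1: "(\<Prod>j\<in>S. 1 + t / (z - x j)) = 1 + (\<Sum>i\<in>S. a i / (z - x i))"
    unfolding a_def by (rule insert.IH) (use insert.prems in auto)
  have 2: "(\<Prod>j\<in>S. 1 + t / (x k - x j)) = 1 + (\<Sum>i\<in>S. a i / (x k - x i))"
    unfolding a_def by (rule insert.IH) (use insert.prems ki in auto)
  have "(\<Prod>j\<in>insert k S. 1 + t / (z - x j)) = (1 + t / (z - x k)) * (1 + (\<Sum>i\<in>S. a i / (z - x i)))"
    using insert.hyps 1 by simp
  also have "\<dots> = 1 + t / (z - x k) + (\<Sum>i\<in>S. a i / (z - x i) * (1 + t / (z - x k)))"
    by (simp add: algebra_simps sum_distrib_left sum.distrib)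
  also have "(\<Sum>i\<in>S. a i / (z - x i) * (1 + t / (z - x k))) =
      (\<Sum>i\<in>S. a i * (1 + t / (x i - x k)) / (z - x i) + t / (z - x k) * (a i / (x k - x i)))"
  proof (rule sum.cong)
    fix i assume "i \<in> S"
    then show "a i / (z - x i) * (1 + t / (z - x k)) =
        a i * (1 + t / (x i - x k)) / (z - x i) + t / (z - x k) * (a i / (x k - x i))"
      using zk zi ki by (intro partial_fractions_two) force+
  qed simp
  also have "\<dots> = (\<Sum>i\<in>S. a i * (1 + t / (x i - x k)) / (z - x i))
      + t / (z - x k) * (\<Sum>i\<in>S. a i / (x k - x i))"
    by (simp add: sum.distrib sum_distrib_left)
  also have "1 + t / (z - x k) + \<dots> = 1 + t * (\<Prod>j\<in>S. 1 + t / (x k - x j)) / (z - x k)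
       + (\<Sum>i\<in>S. a i * (1 + t / (x i - x k)) / (z - x i))"
    unfolding 2 by (simp add: distrib_left add_divide_distrib)
  also have "\<dots> = 1 + (\<Sum>i\<in>insert k S. t * shift_ratio (insert k S) x t i / (z - x i))"
    using insert.hyps by (simp add: shift_ratio_insert a_def mult.assoc)
  finally show ?case .
qed

text \<open>Up to a factor \<open>t\<close> these sums are the coefficients of \<open>1/z\<close>
  and \<open>1/z^2\<close> at infinity in \<open>prod_partial_fractions\<close>. The induction
  avoids the expansion: the partial fractions of the new ratio are paired with the changes of the
  old ones.\<close>

lemma sum_shift_ratio:
  assumes "finite S" "inj_on x S"
  shows "(\<Sum>i\<in>S. shift_ratio S x t i) = card S"
    and "(\<Sum>i\<in>S. x i * shift_ratio S x t i) = (\<Sum>i\<in>S. x i) + t * (card S * (real (card S) - 1) / 2)"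
proof -
  have "(\<Sum>i\<in>S. shift_ratio S x t i) = card S \<and>
    (\<Sum>i\<in>S. x i * shift_ratio S x t i) = (\<Sum>i\<in>S. x i) + t * (card S * (real (card S) - 1) / 2)"
    using assms
  proof (induction S rule: finite_induct)
    case (insert k S)
    define a where "a i = shift_ratio S x t i" for i
    have inj: "inj_on x S" and ki: "\<And>i. i \<in> S \<Longrightarrow> x k \<noteq> x i"
      using insert.prems insert.hyps by (auto simp: inj_on_def)
    have IH: "(\<Sum>i\<in>S. a i) = card S"
        "(\<Sum>i\<in>S. x i * a i) = (\<Sum>i\<in>S. x i) + t * (card S * (real (card S) - 1) / 2)"
      using insert.IH[OF inj] by (auto simp: a_def)
    have pf: "(\<Prod>j\<in>S. 1 + t / (x k - x j)) = 1 + (\<Sum>i\<in>S. t * a i / (x k - x i))"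
      unfolding a_def by (rule prod_partial_fractions) (use insert.hyps inj ki in auto)
    \<comment> \<open>In each pair the pole at \<open>x k = x i\<close> cancels. It leaves nothing
      extra in the plain sum and \<open>t * a i\<close> in the weighted one.\<close>
    have 1: "t * a i / (x k - x i) + a i * (1 + t / (x i - x k)) = a i"
      and 2: "x k * (t * a i / (x k - x i)) + x i * (a i * (1 + t / (x i - x k))) = x i * a i + t * a i"
      if "i \<in> S" for i
      using ki[OF that] by (auto simp: divide_simps) (auto simp: algebra_simps)
    have "(\<Sum>i\<in>insert k S. shift_ratio (insert k S) x t i) =
        1 + (\<Sum>i\<in>S. t * a i / (x k - x i) + a i * (1 + t / (x i - x k)))"
      using insert.hyps by (simp add: shift_ratio_insert pf sum.distrib a_def)
    also have "\<dots> = 1 + (\<Sum>i\<in>S. a i)"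
      using 1 by simp
    finally have A: "(\<Sum>i\<in>insert k S. shift_ratio (insert k S) x t i) = card (insert k S)"
      using IH insert.hyps by simp
    have "(\<Sum>i\<in>insert k S. x i * shift_ratio (insert k S) x t i) =
        x k * (1 + (\<Sum>i\<in>S. t * a i / (x k - x i))) + (\<Sum>i\<in>S. x i * (a i * (1 + t / (x i - x k))))"
      using insert.hyps by (simp add: shift_ratio_insert pf a_def)
    also have "\<dots> = x k + (\<Sum>i\<in>S. x k * (t * a i / (x k - x i)) + x i * (a i * (1 + t / (x i - x k))))"
      by (simp add: sum.distrib sum_distrib_left distrib_left)
    also have "\<dots> = x k + (\<Sum>i\<in>S. x i * a i + t * a i)"
      using 2 by simp
    also have "\<dots> = x k + (\<Sum>i\<in>S. x i * a i) + t * (\<Sum>i\<in>S. a i)"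
      by (simp add: sum.distrib sum_distrib_left)
    finally show ?case using A IH insert.hyps by (simp add: field_simps)
  qed simp
  then show "(\<Sum>i\<in>S. shift_ratio S x t i) = card S"
    and "(\<Sum>i\<in>S. x i * shift_ratio S x t i) = (\<Sum>i\<in>S. x i) + t * (card S * (real (card S) - 1) / 2)"
    by auto
qed

section \<open>Vandermonde products at real points\<close>

definition vdm :: "nat \<Rightarrow> (nat \<Rightarrow> real) \<Rightarrow> real" where
  "vdm M x = (\<Prod>(i, j) \<in> {(i, j). i < j \<and> j < M}. x i - x j)"

lemma finite_index_pairs [simp]: "finite {(i, j). i < j \<and> j < (M::nat)}"
  by (rule finite_subset[of _ "{..<M} \<times> {..<M}"]) auto

lemma vdm_Suc: "vdm (Suc M) x = vdm M x * (\<Prod>i<M. x i - x M)"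
proof -
  have "{(i, j). i < j \<and> j < Suc M} = {(i, j). i < j \<and> j < M} \<union> (\<lambda>i. (i, M)) ` {..<M}"
    by (auto simp: less_Suc_eq)
  moreover have "(\<Prod>(i, j)\<in>(\<lambda>i. (i, M)) ` {..<M}. x i - x j) = (\<Prod>i<M. x i - x M)"
    by (subst prod.reindex) (auto simp: inj_on_def)
  ultimately show ?thesis
    unfolding vdm_def by (simp, subst prod.union_disjoint) auto
qed

lemma vdm_cong: "(\<And>i. i < M \<Longrightarrow> x i = y i) \<Longrightarrow> vdm M x = vdm M y"
  unfolding vdm_def by (rule prod.cong) auto

lemma vdm_eq_0:
  assumes "i < j" "j < M" "x i = x j"
  shows "vdm M x = 0"
  unfolding vdm_def using assms by (intro prod_zero bexI[of _ "(i, j)"]) auto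

text \<open>These are the points of the empty partition; the value is the constant in Frobenius'
  formula and in the Meixner masses.\<close>

lemma vdm_staircase: "vdm M (\<lambda>i. - real i) = (\<Prod>j<M. fact j)"
proof (induction M)
  case (Suc M)
  have "(\<Prod>i<M. - real i - - real M) = (\<Prod>i<M. real (M - i))"
    by (intro prod.cong) auto
  also have "\<dots> = (\<Prod>i<M. real (Suc i))"
    by (subst prod.nat_diff_reindex[symmetric]) (simp add: Suc_diff_Suc cong: prod.cong_simp)
  also have "\<dots> = fact M"
    by (induction M) auto
  finally show ?case using Suc by (simp add: vdm_Suc)
qed (simp add: vdm_def)

text \<open>Only the factors containing \<open>x k\<close> change, and each is multiplied by
  \<open>1 + t / (x k - x j)\<close>, on whichever side of \<open>k\<close> the index
  \<open>j\<close> lies.\<close>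

lemma vdm_shift:
  assumes "k < M" "inj_on x {..<M}"
  shows "vdm M (x(k := x k + t)) = vdm M x * shift_ratio {..<M} x t k"
  using assms
proof (induction M)
  case (Suc M)
  have inj: "inj_on x {..<M}" using Suc.prems(2) by (auto simp: inj_on_def)
  show ?case
  proof (cases "k = M")
    case True
    define y where "y = x(k := x k + t)"
    have "(\<Prod>i<M. y i - y M) = (\<Prod>i<M. (x i - x M) * (1 + t / (x M - x i)))"
    proof (intro prod.cong refl)
      fix i assume "i \<in> {..<M}"
      then have "x M - x i \<noteq> 0" "i \<noteq> M" by (auto simp: inj_on_eq_iff[OF Suc.prems(2)])
      then show "y i - y M = (x i - x M) * (1 + t / (x M - x i))"
        using True by (simp add: field_simps y_def)
    qed
    moreover have "vdm M y = vdm M x" unfolding y_def using True by (intro vdm_cong) auto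
    ultimately show ?thesis unfolding y_def[symmetric] using True
      by (simp add: vdm_Suc lessThan_Suc shift_ratio_insert prod.distrib)
  next
    case False
    then have k: "k < M" using Suc.prems by simp
    have ne: "x k - x M \<noteq> 0" using k by (simp add: inj_on_eq_iff[OF Suc.prems(2)])
    have "(\<Prod>i<M. (x(k := x k + t)) i - x M) = (\<Prod>i<M. (x i - x M) * (if i = k then 1 + t / (x k - x M) else 1))"
      using ne by (intro prod.cong refl) (auto simp: field_simps)
    also have "\<dots> = (\<Prod>i<M. x i - x M) * (1 + t / (x k - x M))"
      using k by (simp add: prod.distrib)
    finally show ?thesis using Suc.IH[OF k inj] k False
      by (simp add: vdm_Suc lessThan_Suc shift_ratio_insert)
  qed
qed simp

text \<open>The two moments in \<open>sum_shift_ratio\<close> make the sum a multiple of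
  \<open>vdm M x\<close>. The constant \<open>c\<close> stays free: removing a box uses
  \<open>M - 1\<close>, adding one uses \<open>M\<close>.\<close>

lemma sum_vdm_shift:
  assumes "inj_on x {..<M}"
  shows "(\<Sum>i<M. (x i + c) * vdm M (x(i := x i + t))) =
         ((\<Sum>i<M. x i) + t * (M * (real M - 1) / 2) + c * M) * vdm M x"
proof -
  have "(\<Sum>i<M. (x i + c) * vdm M (x(i := x i + t))) =
      vdm M x * (\<Sum>i<M. x i * shift_ratio {..<M} x t i + c * shift_ratio {..<M} x t i)"
    unfolding sum_distrib_left
    by (intro sum.cong refl, subst vdm_shift) (use assms in \<open>auto simp: algebra_simps\<close>)
  also have "\<dots> = vdm M x * ((\<Sum>i<M. x i) + t * (M * (real M - 1) / 2) + c * M)"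
    using sum_shift_ratio[OF finite_lessThan assms, of t]
    by (simp add: sum.distrib sum_distrib_left[symmetric])
  finally show ?thesis by (simp add: mult.commute)
qed

section \<open>Partitions and standard tableaux\<close>

lemma parts_upto_iff: "l \<in> parts_upto M \<longleftrightarrow> antimono l \<and> (\<forall>i\<ge>M. l i = 0)"
proof -
  have "finite {i. l i \<noteq> 0}" if "\<forall>i\<ge>M. l i = 0"
    by (rule finite_subset[of _ "{..<M}"]) (use that in \<open>force simp: not_less[symmetric]\<close>)+
  then show ?thesis by (auto simp: parts_upto_def parts_def)
qed

lemma psize_eq_sum:
  assumes "\<forall>i\<ge>M. l i = 0"
  shows "psize l = (\<Sum>i<M. l i)"
  unfolding psize_def
  by (rule sum.mono_neutral_left) (use assms in \<open>force simp: not_less[symmetric]\<close>)+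

lemma psize_update:
  assumes "l \<in> parts_upto M" "i < M"
  shows "psize (l(i := k)) + l i = psize l + k"
proof -
  have "psize (l(i := k)) = (\<Sum>j<M. (l(i := k)) j)"
    by (rule psize_eq_sum) (use assms in \<open>auto simp: parts_upto_iff\<close>)
  moreover have "psize l = (\<Sum>j<M. l j)"
    by (rule psize_eq_sum) (use assms in \<open>auto simp: parts_upto_iff\<close>)
  moreover have "(\<Sum>j<M. (l(i := k)) j) = k + (\<Sum>j\<in>{..<M} - {i}. l j)"
    using assms by (subst sum.remove[of _ i]) auto
  moreover have "(\<Sum>j<M. l j) = l i + (\<Sum>j\<in>{..<M} - {i}. l j)"
    using assms by (subst sum.remove[of _ i]) auto
  ultimately show ?thesis by simp
qed

lemma parts_of_subset_upto: "parts_of n \<subseteq> parts_upto n"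
proof
  fix l assume l: "l \<in> parts_of n"
  then have anti: "antimono l" and fin: "finite {i. l i \<noteq> 0}" and sz: "psize l = n"
    by (auto simp: parts_of_def parts_def)
  have "l i = 0" if "i \<ge> n" for i
  proof (rule ccontr)
    assume "l i \<noteq> 0"
    then have pos: "l j \<ge> 1" if "j \<le> i" for j
      using antimonoD[OF anti that] by simp
    have "Suc i = (\<Sum>j\<le>i. 1)" by simp
    also have "\<dots> \<le> (\<Sum>j\<le>i. l j)" by (intro sum_mono) (use pos in auto)
    also have "\<dots> \<le> psize l"
      unfolding psize_def by (rule sum_mono2) (use fin pos in force)+
    finally show False using sz that by simp
  qed
  then show "l \<in> parts_upto n" using anti by (auto simp: parts_upto_iff)
qed

lemma finite_parts_of [simp]: "finite (parts_of n)"
proof (rule finite_subset)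
  show "parts_of n \<subseteq> {l. \<forall>i. (i \<in> {..<n} \<longrightarrow> l i \<in> {..n}) \<and> (i \<notin> {..<n} \<longrightarrow> l i = 0)}"
  proof (rule subsetI, rule CollectI, intro allI conjI impI)
    fix l i assume l: "l \<in> parts_of n"
    then have up: "l \<in> parts_upto n" using parts_of_subset_upto by auto
    have sum: "(\<Sum>j<n. l j) = n"
      using l psize_eq_sum[of n l] up by (auto simp: parts_of_def parts_upto_iff)
    show "l i \<in> {..n}" if "i \<in> {..<n}"
      using sum member_le_sum[of i "{..<n}" l] that by simp
    show "l i = 0" if "i \<notin> {..<n}" using up that by (auto simp: parts_upto_iff)
  qed
qed (intro finite_set_of_finite_funs; simp)

lemma UN_parts_of: "(\<Union>n. parts_of n) = parts"
  by (auto simp: parts_of_def)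

text \<open>The finite levels of the Meixner state space. For \<open>n \<le> M\<close> a level no
  longer depends on \<open>M\<close> (\<open>parts_of_upto_eq\<close>), which makes limits level by
  level possible.\<close>

definition parts_of_upto :: "nat \<Rightarrow> nat \<Rightarrow> (nat \<Rightarrow> nat) set" where
  "parts_of_upto M n = parts_of n \<inter> parts_upto M"

lemma parts_of_upto_iff:
  "l \<in> parts_of_upto M n \<longleftrightarrow> antimono l \<and> (\<forall>i\<ge>M. l i = 0) \<and> psize l = n"
  unfolding parts_of_upto_def parts_of_def parts_upto_iff
  by (auto simp: parts_upto_iff[unfolded parts_upto_def, symmetric])
     (use parts_upto_iff[of l M] in \<open>auto simp: parts_upto_def\<close>)

lemma finite_parts_of_upto [simp]: "finite (parts_of_upto M n)"
  by (simp add: parts_of_upto_def)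

lemma parts_of_upto_eq: "n \<le> M \<Longrightarrow> parts_of_upto M n = parts_of n"
  using parts_of_subset_upto[of n] by (force simp: parts_of_upto_def parts_upto_iff)

lemma parts_of_upto_0: "parts_of_upto M 0 = {\<lambda>_. 0}"
proof -
  have "l = (\<lambda>_. 0)" if "l \<in> parts_of 0" for l
    using subsetD[OF parts_of_subset_upto that] by (auto simp: parts_upto_iff)
  moreover have "(\<lambda>_. 0) \<in> parts_of_upto M 0"
    by (auto simp: parts_of_upto_iff psize_def monotone_def)
  ultimately show ?thesis by (auto simp: parts_of_upto_def)
qed

lemma antimono_update:
  fixes l :: "nat \<Rightarrow> nat"
  assumes "antimono l" "l (Suc i) \<le> k" "i = 0 \<or> k \<le> l (i - 1)"
  shows "antimono (l(i := k))"
proof (unfold decseq_Suc_iff, intro allI)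
  fix n show "(l(i := k)) (Suc n) \<le> (l(i := k)) n"
    using assms antimonoD[OF assms(1), of n "Suc n"] by (auto split: if_splits)
qed

lemma remove_box:
  assumes "l \<in> parts_of_upto M (Suc n)" "l (Suc i) < l i"
  shows "l(i := l i - 1) \<in> parts_of_upto M n" "i < M"
proof -
  have l: "antimono l" "\<forall>i\<ge>M. l i = 0" "psize l = Suc n"
    using assms by (auto simp: parts_of_upto_iff)
  show i: "i < M" using l(2) assms(2) by (metis not_less not_less0)
  have "antimono (l(i := l i - 1))"
    by (rule antimono_update[OF l(1)]) (use assms antimonoD[OF l(1), of "i - 1" i] in auto)
  moreover have "psize (l(i := l i - 1)) = n"
    using psize_update[of l M i "l i - 1"] l i assms(2) by (auto simp: parts_upto_iff)
  ultimately show "l(i := l i - 1) \<in> parts_of_upto M n"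
    using l(2) i by (auto simp: parts_of_upto_iff)
qed

lemma add_box:
  assumes "l \<in> parts_of_upto M n" "i < M" "i = 0 \<or> l i < l (i - 1)"
  shows "l(i := Suc (l i)) \<in> parts_of_upto M (Suc n)"
proof -
  have l: "antimono l" "\<forall>i\<ge>M. l i = 0" "psize l = n"
    using assms by (auto simp: parts_of_upto_iff)
  have "antimono (l(i := Suc (l i)))"
    by (rule antimono_update[OF l(1)]) (use assms antimonoD[OF l(1), of i "Suc i"] in auto)
  moreover have "psize (l(i := Suc (l i))) = Suc n"
    using psize_update[of l M i "Suc (l i)"] l assms(2) by (auto simp: parts_upto_iff)
  ultimately show ?thesis
    using l(2) assms(2) by (auto simp: parts_of_upto_iff)
qed

lemma disjoint_parts_of: "disjoint_family parts_of"
  by (auto simp: disjoint_family_on_def parts_of_def)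

lemma disjoint_parts_of_upto: "disjoint_family (parts_of_upto M)"
  by (auto simp: disjoint_family_on_def parts_of_upto_iff)

lemma UN_parts_of_upto: "(\<Union>n. parts_of_upto M n) = parts_upto M"
  by (auto simp: parts_of_upto_iff parts_upto_iff)

section \<open>Standard tableaux and removal of the largest entry\<close>

lemma num_syt_zero: "num_syt (\<lambda>_. 0) = 1"
proof -
  have "standard_tableaux (\<lambda>_. 0) = {\<lambda>_. undefined}"
    by (auto simp: standard_tableaux_def cells_def psize_def bij_betw_def)
  then show ?thesis by (simp add: num_syt_def)
qed

lemma finite_cells:
  assumes "l \<in> parts_upto M"
  shows "finite (cells l)"
proof (rule finite_subset)
  show "cells l \<subseteq> Sigma {..<M} (\<lambda>i. {..<l i})"
    using assms by (auto simp: cells_def parts_upto_iff) (metis not_less not_less0)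
qed auto

lemma finite_standard_tableaux:
  assumes "l \<in> parts_upto M"
  shows "finite (standard_tableaux l)"
proof (rule finite_subset)
  show "standard_tableaux l \<subseteq> cells l \<rightarrow>\<^sub>E {1..psize l}"
    by (auto simp: standard_tableaux_def PiE_def bij_betw_def)
qed (intro finite_PiE finite_cells[OF assms]; simp)

text \<open>Forgetting the largest entry at the corner \<open>c\<close> and writing it back are
  mutually inverse; extensionality settles the values outside the cells.\<close>

lemma standard_tableaux_corner:
  assumes l: "l \<in> parts_of_upto M (Suc n)" and i: "l (Suc i) < l i"
  defines "c \<equiv> (i, l i - 1)"
  shows "card {T \<in> standard_tableaux l. T c = Suc n} = num_syt (l(i := l i - 1))"
  unfolding num_syt_def
proof (rule bij_betw_same_card)
  define l' where "l' = l(i := l i - 1)"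
  have anti: "antimono l" "antimono l'" and sz: "psize l = Suc n" "psize l' = n"
    using l remove_box[OF l i] by (auto simp: parts_of_upto_iff l'_def)
  have cells: "cells l = insert c (cells l')" "c \<notin> cells l'"
    using i by (auto simp: cells_def l'_def c_def split: if_splits)
  \<comment> \<open>As \<open>c\<close> is a corner, it is not the left or upper neighbour of any
    cell of \<open>l\<close>, so these neighbours lie in the smaller shape.\<close>
  have left: "(a, b) \<in> cells l'" if "(a, Suc b) \<in> cells l" for a b
    using that by (auto simp: cells_def l'_def)
  have up: "(a, b) \<in> cells l'" if "(Suc a, b) \<in> cells l" for a b
    using that i antimonoD[OF anti(1), of a "Suc a"] by (auto simp: cells_def l'_def)
  have ivl: "{1..Suc n} = {1..n} \<union> {Suc n}" by auto
  show "bij_betw (\<lambda>T. restrict T (cells l')) {T \<in> standard_tableaux l. T c = Suc n}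
          (standard_tableaux (l(i := l i - 1)))"
    unfolding l'_def[symmetric]
  proof (rule bij_betw_byWitness[where f' = "\<lambda>S. S(c := Suc n)"])
    show "\<forall>T\<in>{T \<in> standard_tableaux l. T c = Suc n}. (restrict T (cells l'))(c := Suc n) = T"
      by (auto simp: standard_tableaux_def cells extensional_def fun_eq_iff)
    show "\<forall>S\<in>standard_tableaux l'. restrict (S(c := Suc n)) (cells l') = S"
      using cells(2) by (auto simp: standard_tableaux_def extensional_def fun_eq_iff)
    show "(\<lambda>T. restrict T (cells l')) ` {T \<in> standard_tableaux l. T c = Suc n} \<subseteq> standard_tableaux l'"
    proof safe
      fix T assume T: "T \<in> standard_tableaux l" "T c = Suc n"
      then have "bij_betw T (cells l' \<union> {c}) ({1..n} \<union> {T c})"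
        unfolding T(2) ivl[symmetric] by (simp add: standard_tableaux_def cells sz)
      then have "bij_betw T (cells l') {1..n}"
        using notIn_Un_bij_betw3[of c "cells l'" T "{1..n}"] cells(2) T(2) by simp
      then have "bij_betw (restrict T (cells l')) (cells l') {1..n}"
        by (simp cong: bij_betw_cong)
      moreover have "restrict T (cells l') (a, b) < restrict T (cells l') (a, Suc b)"
        if "(a, Suc b) \<in> cells l'" for a b
      proof -
        have "T (a, b) < T (a, Suc b)" using T(1) that cells(1) by (simp add: standard_tableaux_def)
        moreover have "(a, b) \<in> cells l'" using left that cells(1) by blast
        ultimately show ?thesis using that by simp
      qed
      moreover have "restrict T (cells l') (a, b) < restrict T (cells l') (Suc a, b)"
        if "(Suc a, b) \<in> cells l'" for a b
      proof -
        have "T (a, b) < T (Suc a, b)" using T(1) that cells(1) by (simp add: standard_tableaux_def)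
        moreover have "(a, b) \<in> cells l'" using up that cells(1) by blast
        ultimately show ?thesis using that by simp
      qed
      ultimately show "restrict T (cells l') \<in> standard_tableaux l'"
        unfolding standard_tableaux_def sz by blast
    qed
    show "(\<lambda>S. S(c := Suc n)) ` standard_tableaux l' \<subseteq> {T \<in> standard_tableaux l. T c = Suc n}"
    proof safe
      fix S assume S: "S \<in> standard_tableaux l'"
      define T where "T = S(c := Suc n)"
      have bS: "bij_betw S (cells l') {1..n}" using S by (simp add: standard_tableaux_def sz)
      have S_le: "S p < Suc n" if "p \<in> cells l'" for p
        using bij_betw_apply[OF bS that] by simp
      have TS: "T p = S p" if "p \<in> cells l'" for p
        using that cells(2) by (auto simp: T_def)
      have "bij_betw T (cells l') {1..n}"
        using bS TS by (simp cong: bij_betw_cong)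
      then have "bij_betw T (cells l' \<union> {c}) ({1..n} \<union> {T c})"
        using notIn_Un_bij_betw3[of c "cells l'" T "{1..n}"] cells(2) by (simp add: T_def)
      then have "bij_betw T (cells l) {1..Suc n}"
        unfolding cells(1) ivl by (simp add: T_def)
      moreover have "T \<in> extensional (cells l)"
        using S by (auto simp: T_def standard_tableaux_def cells extensional_def)
      moreover have "T (a, b) < T (a, Suc b)" if "(a, Suc b) \<in> cells l" for a b
      proof (cases "(a, Suc b) = c")
        case True
        then show ?thesis using left[OF that] S_le TS by (simp add: T_def)
      next
        case False
        then have "(a, Suc b) \<in> cells l'" using that cells by auto
        then show ?thesis using left[OF that] S TS by (auto simp: standard_tableaux_def)
      qed
      moreover have "T (a, b) < T (Suc a, b)" if "(Suc a, b) \<in> cells l" for a b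
      proof (cases "(Suc a, b) = c")
        case True
        then show ?thesis using up[OF that] S_le TS by (simp add: T_def)
      next
        case False
        then have "(Suc a, b) \<in> cells l'" using that cells by auto
        then show ?thesis using up[OF that] S TS by (auto simp: standard_tableaux_def)
      qed
      ultimately show "S(c := Suc n) \<in> standard_tableaux l"
        unfolding T_def[symmetric] standard_tableaux_def sz by blast
    qed auto
  qed
qed

text \<open>Tableaux are sorted by the position of the largest entry, which must be the end of a row
  longer than the next one.\<close>

lemma num_syt_rec:
  assumes l: "l \<in> parts_of_upto M (Suc n)"
  shows "num_syt l = (\<Sum>i | l (Suc i) < l i. num_syt (l(i := l i - 1)))"
proof -
  define C where "C = {i. l (Suc i) < l i}"
  define A where "A i = {T \<in> standard_tableaux l. T (i, l i - 1) = Suc n}" for i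
  have up: "l \<in> parts_upto M" using l by (simp add: parts_of_upto_def)
  have sz: "psize l = Suc n" using l by (simp add: parts_of_upto_iff)
  have finC: "finite C"
    by (rule finite_subset[of _ "{..<M}"]) (use remove_box[OF l] in \<open>auto simp: C_def\<close>)
  have "standard_tableaux l = (\<Union>i\<in>C. A i)"
  proof
    show "standard_tableaux l \<subseteq> (\<Union>i\<in>C. A i)"
    proof
      fix T assume T: "T \<in> standard_tableaux l"
      then have bij: "bij_betw T (cells l) {1..Suc n}" by (simp add: standard_tableaux_def sz)
      then have "Suc n \<in> T ` cells l" by (auto simp: bij_betw_def)
      then obtain i j where ij: "(i, j) \<in> cells l" "T (i, j) = Suc n" by auto
      have le: "T p \<le> Suc n" if "p \<in> cells l" for p using bij that by (auto simp: bij_betw_def)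
      \<comment> \<open>A right or lower neighbour of the cell holding \<open>Suc n\<close> would
        carry a still larger entry.\<close>
      have "(i, Suc j) \<notin> cells l" "(Suc i, j) \<notin> cells l"
        using T le ij(2) by (fastforce simp: standard_tableaux_def)+
      then have "l i = Suc j" "l (Suc i) < l i" using ij(1) by (auto simp: cells_def)
      then show "T \<in> (\<Union>i\<in>C. A i)" using T ij by (intro UN_I[of i]) (auto simp: A_def C_def)
    qed
  qed (auto simp: A_def)
  then have "num_syt l = card (\<Union>i\<in>C. A i)" by (simp add: num_syt_def)
  also have "\<dots> = (\<Sum>i\<in>C. card (A i))"
  proof (rule card_UN_disjoint[OF finC])
    show "\<forall>i\<in>C. finite (A i)" using finite_standard_tableaux[OF up] by (auto simp: A_def)
    show "\<forall>i\<in>C. \<forall>j\<in>C. i \<noteq> j \<longrightarrow> A i \<inter> A j = {}"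
    proof (intro ballI impI, rule ccontr)
      fix i j assume ij: "i \<in> C" "j \<in> C" "i \<noteq> j" "A i \<inter> A j \<noteq> {}"
      then obtain T where "T \<in> A i" "T \<in> A j" by blast
      then have T: "inj_on T (cells l)" "T (i, l i - 1) = T (j, l j - 1)"
        by (auto simp: A_def standard_tableaux_def bij_betw_def)
      have "(i, l i - 1) \<in> cells l" "(j, l j - 1) \<in> cells l"
        using ij by (auto simp: C_def cells_def)
      then show False using T ij(3) by (auto dest: inj_onD)
    qed
  qed
  also have "\<dots> = (\<Sum>i\<in>C. num_syt (l(i := l i - 1)))"
    unfolding A_def by (intro sum.cong refl standard_tableaux_corner[OF l]) (simp add: C_def)
  finally show ?thesis by (simp add: C_def)
qed

section \<open>Frobenius' formula and the sum of squared Vandermonde products\<close>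

lemma vandermonde_parts_eq_vdm: "vandermonde_parts M l = vdm M (\<lambda>i. real (l i) - real i)"
  unfolding vandermonde_parts_def vdm_def by (rule prod.cong) auto

lemma vandermonde_parts_zero: "vandermonde_parts M (\<lambda>_. 0) = (\<Prod>j<M. fact j)"
  using vdm_staircase[of M] by (simp add: vandermonde_parts_eq_vdm)

text \<open>Subtracting the row index turns a weakly decreasing sequence into a strictly decreasing
  one, as the Vandermonde identities require.\<close>

lemma inj_on_shifted:
  assumes "antimono (l :: nat \<Rightarrow> nat)"
  shows "inj_on (\<lambda>i. real (l i) - real i) A"
proof (rule linorder_inj_onI)
  fix i j :: nat assume "i < j"
  then have "l j \<le> l i" using antimonoD[OF assms, of i j] by simp
  then show "real (l i) - real i \<noteq> real (l j) - real j" using \<open>i < j\<close> by simp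
qed auto

lemma sum_shifted:
  assumes "l \<in> parts_of_upto M n"
  shows "(\<Sum>i<M. real (l i) - real i) = real n - real M * (real M - 1) / 2"
proof -
  have "(\<Sum>i<M. real (l i)) = real n"
    using assms psize_eq_sum[of M l] by (auto simp: parts_of_upto_iff)
  moreover have "(\<Sum>i<M. real i) = real M * (real M - 1) / 2"
    by (induction M) (auto simp: field_simps)
  ultimately show ?thesis by (simp add: sum_subtractf)
qed

text \<open>This is \<open>sum_vdm_shift\<close> with \<open>t = -1\<close> and
  \<open>c = M - 1\<close>, where the scalar becomes \<open>n + 1\<close>. Rows without a removable
  box contribute nothing.\<close>

lemma sum_vandermonde_remove_box:
  assumes l: "l \<in> parts_of_upto M (Suc n)"
  shows "(\<Sum>i | l (Suc i) < l i. (real (l i) + real M - 1 - real i) * vandermonde_parts M (l(i := l i - 1)))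
         = (real n + 1) * vandermonde_parts M l"
proof -
  define x where "x i = real (l i) - real i" for i
  have anti: "antimono l" and z: "\<forall>i\<ge>M. l i = 0" using l by (auto simp: parts_of_upto_iff)
  have shift: "(\<lambda>j. real ((l(i := l i - 1)) j) - real j) = x(i := x i + - 1)" if "l (Suc i) < l i" for i
    using that by (auto simp: x_def fun_eq_iff)
  have "(\<Sum>i | l (Suc i) < l i. (real (l i) + real M - 1 - real i) * vandermonde_parts M (l(i := l i - 1)))
     = (\<Sum>i | l (Suc i) < l i. (x i + (real M - 1)) * vdm M (x(i := x i + - 1)))"
    unfolding vandermonde_parts_eq_vdm
    by (intro sum.cong refl, subst shift) (auto simp: x_def)
  also have "\<dots> = (\<Sum>i<M. (x i + (real M - 1)) * vdm M (x(i := x i + - 1)))"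
  proof (rule sum.mono_neutral_left)
    show "{i. l (Suc i) < l i} \<subseteq> {..<M}" using remove_box(2)[OF l] by auto
    show "\<forall>i\<in>{..<M} - {i. l (Suc i) < l i}. (x i + (real M - 1)) * vdm M (x(i := x i + - 1)) = 0"
    proof
      fix i assume "i \<in> {..<M} - {i. l (Suc i) < l i}"
      then have i: "i < M" "l (Suc i) = l i"
        using antimonoD[OF anti, of i "Suc i"] by auto
      show "(x i + (real M - 1)) * vdm M (x(i := x i + - 1)) = 0"
      \<comment> \<open>Either the lowered point collides with the next one, or \<open>i\<close> is
        the last row and empty, so that the weight \<open>x i + (M - 1)\<close> is 0.\<close>
      proof (cases "Suc i < M")
        case True
        have "vdm M (x(i := x i + - 1)) = 0"
          by (rule vdm_eq_0[of i "Suc i"]) (use True i in \<open>auto simp: x_def\<close>)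
        then show ?thesis by simp
      next
        case False
        then have "M = Suc i" using i by simp
        then show ?thesis using i z by (simp add: x_def)
      qed
    qed
  qed simp
  also have "\<dots> = (real n + 1) * vdm M x"
    using sum_vdm_shift[of x M "real M - 1" "-1"] inj_on_shifted[OF anti] sum_shifted[OF l]
    by (simp add: x_def[abs_def] field_simps)
  finally show ?thesis by (simp add: vandermonde_parts_eq_vdm x_def[abs_def])
qed

text \<open>This is \<open>sum_vdm_shift\<close> with \<open>t = 1\<close> and \<open>c = M\<close>.
  If row \<open>i\<close> is as long as row \<open>i - 1\<close>, the raised point collides with the
  previous one. The weight of an added box equals the weight of its removal in
  \<open>sum_vandermonde_remove_box\<close>.\<close>

lemma sum_vandermonde_add_box:
  assumes l: "l \<in> parts_of_upto M n"
  shows "(\<Sum>i | i < M \<and> (i = 0 \<or> l i < l (i - 1)).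
            (real (l i) + real M - real i) * vandermonde_parts M (l(i := Suc (l i))))
         = (real n + (real M)\<^sup>2) * vandermonde_parts M l"
proof -
  define x where "x i = real (l i) - real i" for i
  have anti: "antimono l" using l by (auto simp: parts_of_upto_iff)
  have shift: "(\<lambda>j. real ((l(i := Suc (l i))) j) - real j) = x(i := x i + 1)" for i
    by (auto simp: x_def fun_eq_iff)
  have "(\<Sum>i | i < M \<and> (i = 0 \<or> l i < l (i - 1)).
            (real (l i) + real M - real i) * vandermonde_parts M (l(i := Suc (l i))))
     = (\<Sum>i | i < M \<and> (i = 0 \<or> l i < l (i - 1)). (x i + real M) * vdm M (x(i := x i + 1)))"
    unfolding vandermonde_parts_eq_vdm shift by (intro sum.cong refl) (auto simp: x_def)
  also have "\<dots> = (\<Sum>i<M. (x i + real M) * vdm M (x(i := x i + 1)))"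
  proof (rule sum.mono_neutral_left)
    show "\<forall>i\<in>{..<M} - {i. i < M \<and> (i = 0 \<or> l i < l (i - 1))}.
       (x i + real M) * vdm M (x(i := x i + 1)) = 0"
    proof
      fix i assume "i \<in> {..<M} - {i. i < M \<and> (i = 0 \<or> l i < l (i - 1))}"
      then have i: "i < M" "i \<noteq> 0" "l i = l (i - 1)"
        using antimonoD[OF anti, of "i - 1" i] by auto
      then obtain k where k: "i = Suc k" by (cases i) auto
      have "vdm M (x(i := x i + 1)) = 0"
        by (rule vdm_eq_0[of k i]) (use i k in \<open>auto simp: x_def\<close>)
      then show "(x i + real M) * vdm M (x(i := x i + 1)) = 0" by simp
    qed
  qed auto
  also have "\<dots> = (real n + (real M)\<^sup>2) * vdm M x"
    using sum_vdm_shift[of x M "real M" 1] inj_on_shifted[OF anti] sum_shifted[OF l]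
    by (simp add: x_def[abs_def] field_simps power2_eq_square)
  finally show ?thesis by (simp add: vandermonde_parts_eq_vdm x_def[abs_def])
qed

text \<open>Both sides satisfy the same recursion over removable boxes, by
  \<open>num_syt_rec\<close> on the left and \<open>sum_vandermonde_remove_box\<close> on the
  right.\<close>

lemma num_syt_frobenius:
  assumes "l \<in> parts_of_upto M n"
  shows "real (num_syt l) * (\<Prod>i<M. fact (l i + (M - Suc i))) = fact n * vandermonde_parts M l"
  using assms
proof (induction n arbitrary: l)
  case 0
  then have "l = (\<lambda>_. 0)" by (simp add: parts_of_upto_0)
  moreover have "(\<Prod>i<M. fact (M - Suc i)) = (\<Prod>i<M. fact i :: real)"
    by (rule prod.nat_diff_reindex)
  ultimately show ?case by (simp add: num_syt_zero vandermonde_parts_zero)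
next
  case (Suc n)
  define H where "H l = (\<Prod>i<M. fact (l i + (M - Suc i)) :: real)" for l
  define d where "d i = l(i := l i - 1)" for i
  \<comment> \<open>Only the factorial of row \<open>i\<close> changes, and the quotient is the
    weight in \<open>sum_vandermonde_remove_box\<close>.\<close>
  have H: "H l = (real (l i) + real M - 1 - real i) * H (d i)" if "l (Suc i) < l i" for i
  proof -
    have iM: "i < M" using remove_box(2)[OF Suc.prems that] .
    have f: "fact (l i + (M - Suc i)) = (real (l i) + real M - 1 - real i) * fact (l i - 1 + (M - Suc i))"
      using that iM by (cases "l i") (auto simp: of_nat_diff algebra_simps)
    have "(\<Prod>j\<in>{..<M} - {i}. fact (d i j + (M - Suc j)) :: real) =
          (\<Prod>j\<in>{..<M} - {i}. fact (l j + (M - Suc j)))"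
      by (intro prod.cong) (auto simp: d_def)
    then show ?thesis
      unfolding H_def using iM f by (simp add: prod.remove[of _ i] d_def)
  qed
  have "real (num_syt l) * H l = (\<Sum>i | l (Suc i) < l i. real (num_syt (d i)) * H l)"
    by (simp add: num_syt_rec[OF Suc.prems] sum_distrib_right d_def)
  also have "\<dots> = (\<Sum>i | l (Suc i) < l i. fact n *
       ((real (l i) + real M - 1 - real i) * vandermonde_parts M (d i)))"
  proof (rule sum.cong, simp, clarsimp)
    fix i assume i: "l (Suc i) < l i"
    have "real (num_syt (d i)) * H (d i) = fact n * vandermonde_parts M (d i)"
      unfolding H_def by (rule Suc.IH) (use remove_box(1)[OF Suc.prems i] in \<open>simp only: d_def\<close>)
    then show "real (num_syt (d i)) * H l =
        fact n * ((real (l i) + real M - 1 - real i) * vandermonde_parts M (d i))"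
      by (simp add: H[OF i] algebra_simps)
  qed
  also have "\<dots> = fact n * ((real n + 1) * vandermonde_parts M l)"
    using sum_vandermonde_remove_box[OF Suc.prems]
    by (simp add: sum_distrib_left[symmetric] d_def)
  finally show ?case by (simp add: H_def algebra_simps)
qed

text \<open>Double counting of pairs of partitions that differ by one box: one factor of the square
  is expanded by removing a box, the pairs are regrouped by the smaller partition, and the inner sum
  collapses by the identity for adding a box.\<close>

lemma sum_vandermonde_sq_Suc:
  "(real n + 1) * (\<Sum>l\<in>parts_of_upto M (Suc n). (vandermonde_parts M l)\<^sup>2) =
   (real n + (real M)\<^sup>2) * (\<Sum>l\<in>parts_of_upto M n. (vandermonde_parts M l)\<^sup>2)"
proof -
  let ?V = "vandermonde_parts M"
  define C where "C l = {i. l (Suc i) < l i}" for l :: "nat \<Rightarrow> nat"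
  define D where "D l = {i. i < M \<and> (i = 0 \<or> l i < l (i - 1))}" for l :: "nat \<Rightarrow> nat"
  have fin: "finite (C l)" if "l \<in> parts_of_upto M (Suc n)" for l
    by (rule finite_subset[of _ "{..<M}"]) (use remove_box(2)[OF that] in \<open>auto simp: C_def\<close>)
  have finD: "finite (D l)" for l by (auto simp: D_def)
  have "(real n + 1) * (\<Sum>l\<in>parts_of_upto M (Suc n). (?V l)\<^sup>2) =
     (\<Sum>l\<in>parts_of_upto M (Suc n). (\<Sum>i\<in>C l.
        (real (l i) + real M - 1 - real i) * ?V (l(i := l i - 1)) * ?V l))"
    using sum_vandermonde_remove_box[of _ M n]
    by (simp add: sum_distrib_left sum_distrib_right[symmetric] C_def power2_eq_square mult.assoc[symmetric]
        cong: sum.cong_simp)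
  also have "\<dots> = (\<Sum>(l, i)\<in>Sigma (parts_of_upto M (Suc n)) C.
        (real (l i) + real M - 1 - real i) * ?V (l(i := l i - 1)) * ?V l)"
    by (rule sum.Sigma) (use fin in auto)
  also have "\<dots> = (\<Sum>(l, i)\<in>Sigma (parts_of_upto M n) D.
        (real (l i) + real M - real i) * ?V (l(i := Suc (l i))) * ?V l)"
  \<comment> \<open>The row index is kept; \<open>l i + M - 1 - i\<close> for the larger partition
    is \<open>l i + M - i\<close> for the smaller one.\<close>
  proof (rule sum.reindex_bij_witness[where i = "\<lambda>(l, i). (l(i := Suc (l i)), i)"
                                        and j = "\<lambda>(l, i). (l(i := l i - 1), i)"])
    fix a assume "a \<in> Sigma (parts_of_upto M (Suc n)) C"
    then obtain l i where a: "a = (l, i)" "l \<in> parts_of_upto M (Suc n)" "l (Suc i) < l i"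
      by (auto simp: C_def)
    have li: "i = 0 \<or> l i \<le> l (i - 1)"
      using a(2) antimonoD[of l "i - 1" i] by (auto simp: parts_of_upto_iff)
    show "(case case a of (l, i) \<Rightarrow> (l(i := l i - 1), i) of (l, i) \<Rightarrow> (l(i := Suc (l i)), i)) = a"
      using a by auto
    show "(case a of (l, i) \<Rightarrow> (l(i := l i - 1), i)) \<in> Sigma (parts_of_upto M n) D"
      using a remove_box[OF a(2,3)] li by (auto simp: D_def)
    show "(case case a of (l, i) \<Rightarrow> (l(i := l i - 1), i) of
        (l, i) \<Rightarrow> (real (l i) + real M - real i) * ?V (l(i := Suc (l i))) * ?V l) =
      (case a of (l, i) \<Rightarrow> (real (l i) + real M - 1 - real i) * ?V (l(i := l i - 1)) * ?V l)"
      using a by (auto simp: of_nat_diff algebra_simps)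
  next
    fix a assume "a \<in> Sigma (parts_of_upto M n) D"
    then obtain l i where a: "a = (l, i)" "l \<in> parts_of_upto M n" "i < M" "i = 0 \<or> l i < l (i - 1)"
      by (auto simp: D_def)
    have li: "l (Suc i) \<le> l i"
      using a(2) antimonoD[of l i "Suc i"] by (auto simp: parts_of_upto_iff)
    show "(case case a of (l, i) \<Rightarrow> (l(i := Suc (l i)), i) of (l, i) \<Rightarrow> (l(i := l i - 1), i)) = a"
      using a by auto
    show "(case a of (l, i) \<Rightarrow> (l(i := Suc (l i)), i)) \<in> Sigma (parts_of_upto M (Suc n)) C"
      using a add_box[OF a(2-4)] li by (auto simp: C_def)
  qed
  also have "\<dots> = (\<Sum>l\<in>parts_of_upto M n. \<Sum>i\<in>D l.
        (real (l i) + real M - real i) * ?V (l(i := Suc (l i))) * ?V l)"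
    by (rule sum.Sigma[symmetric]) (use finD in auto)
  also have "\<dots> = (real n + (real M)\<^sup>2) * (\<Sum>l\<in>parts_of_upto M n. (?V l)\<^sup>2)"
    using sum_vandermonde_add_box[of _ M n]
    by (simp add: sum_distrib_left sum_distrib_right[symmetric] D_def power2_eq_square mult.assoc[symmetric]
        cong: sum.cong_simp)
  finally show ?thesis .
qed

text \<open>The last product is the rising factorial of \<open>M^2\<close> divided by
  \<open>n!\<close>, the coefficient of a negative binomial law.\<close>

lemma sum_vandermonde_sq:
  "(\<Sum>l\<in>parts_of_upto M n. (vandermonde_parts M l)\<^sup>2) =
   (\<Prod>j<M. fact j)\<^sup>2 * (\<Prod>k<n. ((real M)\<^sup>2 + real k) / (real k + 1))"
proof (induction n)
  case 0
  then show ?case by (simp add: parts_of_upto_0 vandermonde_parts_zero)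
next
  case (Suc n)
  have "(\<Sum>l\<in>parts_of_upto M (Suc n). (vandermonde_parts M l)\<^sup>2) =
    ((real M)\<^sup>2 + real n) / (real n + 1) * (\<Sum>l\<in>parts_of_upto M n. (vandermonde_parts M l)\<^sup>2)"
    using sum_vandermonde_sq_Suc[of n M] by (simp add: field_simps)
  then show ?case using Suc by simp
qed

section \<open>Level weights and convergence of the masses\<close>

text \<open>For \<open>b > 0\<close> these are negative binomial weights without normalization, for
  \<open>b = 0\<close> the Poisson weights \<open>a^n / n!\<close>. One formula for both makes the
  limit \<open>b -> 0\<close> immediate.\<close>

definition level_weight :: "real \<Rightarrow> real \<Rightarrow> nat \<Rightarrow> real" where
  "level_weight a b n = (\<Prod>k<n. (a + b * real k) / (real k + 1))"

lemma level_weight_nonneg: "0 \<le> a \<Longrightarrow> 0 \<le> b \<Longrightarrow> 0 \<le> level_weight a b n"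
  by (auto simp: level_weight_def intro!: prod_nonneg)

lemma level_weight_mono:
  "0 \<le> a \<Longrightarrow> 0 \<le> b \<Longrightarrow> b \<le> b' \<Longrightarrow> level_weight a b n \<le> level_weight a b' n"
  unfolding level_weight_def
  by (intro prod_mono) (auto intro!: divide_right_mono mult_right_mono)

text \<open>Lets the exponential growth of an observable be absorbed into the parameters.\<close>

lemma level_weight_scale: "c ^ n * level_weight a b n = level_weight (c * a) (c * b) n"
  by (induction n) (auto simp: level_weight_def field_simps)

text \<open>The ratio \<open>(a + b n) / (n + 1)\<close> of consecutive terms tends to
  \<open>b\<close>, so the midpoint \<open>c\<close> of \<open>b\<close> and 1 serves in the ratio
  test.\<close>

lemma summable_level_weight:
  assumes "0 \<le> a" "0 \<le> b" "b < 1"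
  shows "summable (level_weight a b)"
proof -
  define c where "c = (1 + b) / 2"
  have c: "c < 1" "b < c" using assms by (auto simp: c_def)
  obtain n0 :: nat where n0: "a / (c - b) < real n0" using reals_Archimedean2 by blast
  show ?thesis
  proof (rule summable_ratio_test[OF c(1)])
    fix n assume "n0 \<le> n"
    then have "a / (c - b) < real n" using n0 by linarith
    then have "a < (c - b) * real n" using c by (simp add: field_simps)
    then have "a + b * real n \<le> c * (real n + 1)" using assms c by (simp add: algebra_simps)
    then have "(a + b * real n) / (real n + 1) \<le> c" by (simp add: divide_le_eq)
    then have "level_weight a b n * ((a + b * real n) / (real n + 1)) \<le> level_weight a b n * c"
      using assms by (intro mult_left_mono level_weight_nonneg)
    moreover have "level_weight a b (Suc n) = level_weight a b n * ((a + b * real n) / (real n + 1))"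
      by (simp add: level_weight_def)
    ultimately show "norm (level_weight a b (Suc n)) \<le> c * norm (level_weight a b n)"
      using assms level_weight_nonneg[of a b] by (simp add: mult.commute)
  qed
qed

text \<open>For \<open>M = N\<close> the binomial coefficients are all 1, so apart from the
  Vandermonde product only the size of \<open>l\<close> matters.\<close>

lemma meixner_mass_eq:
  assumes "l \<in> parts_of_upto N n"
  shows "meixner_mass N N q l =
    (1 - q) ^ (N * N) * (vandermonde_parts N l / (\<Prod>j<N. fact j))\<^sup>2 * q ^ n"
proof -
  have n: "(\<Sum>i<N. l i) = n"
    using assms psize_eq_sum[of N l] by (auto simp: parts_of_upto_iff)
  have "(\<Prod>j<N. fact (N - N) / (fact j * fact (N - N + j))) = 1 / (\<Prod>j<N. fact j :: real)\<^sup>2"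
    by (simp add: prod_dividef prod.distrib power2_eq_square)
  moreover have "(\<Prod>i<N. real ((l i + (N - Suc i)) choose (l i + (N - Suc i))) * q ^ l i) = q ^ n"
    by (simp add: power_sum[symmetric] n)
  ultimately show ?thesis unfolding meixner_mass_def by (simp add: power_divide)
qed

lemma meixner_mass_nonneg:
  assumes "l \<in> parts_upto N" "0 \<le> q" "q \<le> 1"
  shows "0 \<le> meixner_mass N N q l"
proof -
  have "l \<in> parts_of_upto N (psize l)"
    using assms by (auto simp: parts_of_upto_def parts_of_def parts_upto_def)
  then show ?thesis using assms by (simp add: meixner_mass_eq)
qed

text \<open>The size of a Meixner partition has a negative binomial law; for
  \<open>q = \<alpha> / N^2\<close> the first parameter of the weight is \<open>\<alpha>\<close>,
  whatever \<open>N\<close> is.\<close>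

lemma sum_meixner_mass:
  "(\<Sum>l\<in>parts_of_upto N n. meixner_mass N N q l) =
     (1 - q) ^ (N * N) * level_weight (q * (real N)\<^sup>2) q n"
proof -
  have "(\<Sum>l\<in>parts_of_upto N n. meixner_mass N N q l) =
     (1 - q) ^ (N * N) * q ^ n * (\<Sum>l\<in>parts_of_upto N n. (vandermonde_parts N l)\<^sup>2) / (\<Prod>j<N. fact j)\<^sup>2"
    by (simp add: meixner_mass_eq sum_distrib_left sum_divide_distrib power_divide algebra_simps)
  also have "\<dots> = (1 - q) ^ (N * N) * (q ^ n * level_weight ((real N)\<^sup>2) 1 n)"
    by (simp add: sum_vandermonde_sq level_weight_def)
  finally show ?thesis by (simp add: level_weight_scale)
qed

text \<open>The quotients of factorials in Frobenius' formula leave one linear factor per box;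
  dividing each of the \<open>n\<close> factors by \<open>N\<close> makes it tend to 1.\<close>

lemma scaled_vandermonde_eq:
  assumes l: "l \<in> parts_of n" and N: "n \<le> N" "0 < N"
  shows "vandermonde_parts N l / (\<Prod>j<N. fact j) / real N ^ n =
     real (num_syt l) / fact n * (\<Prod>i<n. \<Prod>k<l i. (real N - real i + real k) / real N)"
proof -
  have lN: "l \<in> parts_of_upto N n" using l N by (simp add: parts_of_upto_eq)
  have z: "l i = 0" if "i \<ge> n" for i
    using subsetD[OF parts_of_subset_upto l] that by (auto simp: parts_upto_iff)
  \<comment> \<open>Used with \<open>r = N - Suc i\<close>, so that \<open>r + 1 + k\<close> is
    \<open>N - i + k\<close>.\<close>
  have fact_shift: "fact (m + r) = fact r * (\<Prod>k<m. real r + 1 + real k)" for m r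
    by (induction m) (auto simp: algebra_simps)
  have n: "(\<Sum>i<n. l i) = n"
    using l psize_eq_sum[of n l] z by (auto simp: parts_of_def)
  have "(\<Prod>i<N. fact (l i + (N - Suc i)) :: real) =
      (\<Prod>i<N. fact (N - Suc i)) * (\<Prod>i<N. \<Prod>k<l i. real N - real i + real k)"
    unfolding prod.distrib[symmetric]
    by (intro prod.cong refl, subst fact_shift) (auto simp: of_nat_diff)
  also have "(\<Prod>i<N. fact (N - Suc i)) = (\<Prod>j<N. fact j :: real)"
    by (rule prod.nat_diff_reindex)
  \<comment> \<open>Rows from \<open>n\<close> on are empty, so the index range stops growing with
    \<open>N\<close>.\<close>
  also have "(\<Prod>i<N. \<Prod>k<l i. real N - real i + real k) = (\<Prod>i<n. \<Prod>k<l i. real N - real i + real k)"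
    by (rule prod.mono_neutral_right) (use N z in auto)
  also have "\<dots> = real N ^ n * (\<Prod>i<n. \<Prod>k<l i. (real N - real i + real k) / real N)"
    using N n by (simp add: prod_dividef power_sum[symmetric])
  finally have "fact n * vandermonde_parts N l = real (num_syt l) *
     ((\<Prod>j<N. fact j) * (real N ^ n * (\<Prod>i<n. \<Prod>k<l i. (real N - real i + real k) / real N)))"
    using num_syt_frobenius[OF lN] by simp
  then show ?thesis using N by (simp add: field_simps)
qed

section \<open>Limits of the individual masses\<close>

lemma tendsto_one_minus_power:
  "(\<lambda>N::nat. (1 - \<alpha> / (real N)\<^sup>2) ^ (N * N)) \<longlonglongrightarrow> exp (- \<alpha>)"
proof -
  \<comment> \<open>The sequence is the subsequence at \<open>N * N\<close> of
    \<open>(1 - \<alpha> / m) ^ m\<close>.\<close>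
  have "filterlim (\<lambda>N::nat. N * N) at_top sequentially"
    by (rule filterlim_at_top_mono[OF filterlim_ident]) auto
  from filterlim_compose[OF tendsto_exp_limit_sequentially[of "-\<alpha>"] this]
  show ?thesis by (simp add: power2_eq_square)
qed

text \<open>Only the term \<open>N = n\<close> of the Poisson mixture survives, since
  \<open>plancherel_mass N\<close> vanishes off the partitions of \<open>N\<close>.\<close>

lemma poisson_plancherel_mass_eq:
  assumes "l \<in> parts_of n"
  shows "poisson_plancherel_mass \<alpha> l = exp (- \<alpha>) * (real (num_syt l) / fact n)\<^sup>2 * \<alpha> ^ n"
proof -
  have "(\<lambda>N. plancherel_mass N l * (\<alpha> ^ N / fact N)) sums (plancherel_mass n l * (\<alpha> ^ n / fact n))"
    by (rule sums_single[where f = "\<lambda>N. plancherel_mass N l * (\<alpha> ^ N / fact N)", of n,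
          THEN sums_cong[THEN iffD1, rotated]])
      (use assms in \<open>auto simp: plancherel_mass_def parts_of_def\<close>)
  then show ?thesis using assms
    by (simp add: poisson_plancherel_mass_def sums_iff plancherel_mass_def power2_eq_square)
qed

lemma poisson_plancherel_mass_nonneg:
  "l \<in> parts \<Longrightarrow> 0 \<le> \<alpha> \<Longrightarrow> 0 \<le> poisson_plancherel_mass \<alpha> l"
  unfolding UN_parts_of[symmetric] by (auto simp: poisson_plancherel_mass_eq)

text \<open>The factor \<open>N^(2n)\<close> from the square of \<open>scaled_vandermonde_eq\<close>
  cancels the denominator of \<open>q^n = \<alpha>^n / N^(2n)\<close>.\<close>

lemma meixner_mass_tendsto:
  assumes l: "l \<in> parts_of n"
  shows "(\<lambda>N. meixner_mass N N (\<alpha> / (real N)\<^sup>2) l) \<longlonglongrightarrow> poisson_plancherel_mass \<alpha> l"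
proof -
  have "(\<lambda>N. (1 - \<alpha> / (real N)\<^sup>2) ^ (N * N) *
      (real (num_syt l) / fact n * (\<Prod>i<n. \<Prod>k<l i. (real N - real i + real k) / real N))\<^sup>2 * \<alpha> ^ n)
     \<longlonglongrightarrow> exp (- \<alpha>) * (real (num_syt l) / fact n * (\<Prod>i<n. \<Prod>k<l i. 1))\<^sup>2 * \<alpha> ^ n"
  proof (intro tendsto_intros tendsto_one_minus_power)
    fix i k
    have "(\<lambda>N. 1 + (real k - real i) / real N) \<longlonglongrightarrow> 1 + 0"
      by (intro tendsto_add tendsto_const lim_const_over_n)
    moreover have "\<forall>\<^sub>F N in sequentially. 1 + (real k - real i) / real N = (real N - real i + real k) / real N"
      using eventually_gt_at_top[of 0] by eventually_elim (simp add: field_simps)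
    ultimately show "(\<lambda>N. (real N - real i + real k) / real N) \<longlonglongrightarrow> 1"
      using Lim_transform_eventually by force
  qed
  then show ?thesis
  proof (rule Lim_transform_eventually[OF tendsto_eq_rhs])
    show "\<forall>\<^sub>F N in sequentially. (1 - \<alpha> / (real N)\<^sup>2) ^ (N * N) *
        (real (num_syt l) / fact n * (\<Prod>i<n. \<Prod>k<l i. (real N - real i + real k) / real N))\<^sup>2 * \<alpha> ^ n
        = meixner_mass N N (\<alpha> / (real N)\<^sup>2) l"
      \<comment> \<open>\<open>Suc n\<close> rather than \<open>n\<close>, so that \<open>N\<close>
        is positive also for \<open>n = 0\<close>.\<close>
      using eventually_ge_at_top[of "Suc n"]
    proof eventually_elim
      case (elim N)
      then have "l \<in> parts_of_upto N n" using l by (simp add: parts_of_upto_eq)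
      then show ?case
        using elim scaled_vandermonde_eq[OF l, of N, symmetric]
        by (simp add: meixner_mass_eq power_divide power_mult_distrib power_mult[symmetric] mult.commute)
    qed
  qed (simp add: poisson_plancherel_mass_eq[OF l])
qed

text \<open>Uniqueness of limits carries the exact Meixner level sums over. For positive
  \<open>\<alpha>\<close> this amounts to the identity that the squares of the tableau counts over
  the partitions of \<open>n\<close> add up to \<open>n!\<close>.\<close>

lemma sum_poisson_plancherel_mass:
  "(\<Sum>l\<in>parts_of n. poisson_plancherel_mass \<alpha> l) = exp (- \<alpha>) * level_weight \<alpha> 0 n"
proof (rule LIMSEQ_unique)
  show "(\<lambda>N. \<Sum>l\<in>parts_of n. meixner_mass N N (\<alpha> / (real N)\<^sup>2) l)
     \<longlonglongrightarrow> (\<Sum>l\<in>parts_of n. poisson_plancherel_mass \<alpha> l)"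
    by (intro tendsto_sum meixner_mass_tendsto)
  have "(\<lambda>N. (1 - \<alpha> / (real N)\<^sup>2) ^ (N * N) * level_weight \<alpha> (\<alpha> / (real N)\<^sup>2) n)
     \<longlonglongrightarrow> exp (- \<alpha>) * level_weight \<alpha> 0 n"
    unfolding level_weight_def
  proof (intro tendsto_intros tendsto_one_minus_power)
    show "(\<lambda>N. \<alpha> / (real N)\<^sup>2) \<longlonglongrightarrow> 0"
      using tendsto_mult[OF lim_const_over_n[of \<alpha>] lim_const_over_n[of 1]] by (simp add: power2_eq_square)
  qed auto
  then show "(\<lambda>N. \<Sum>l\<in>parts_of n. meixner_mass N N (\<alpha> / (real N)\<^sup>2) l)
     \<longlonglongrightarrow> exp (- \<alpha>) * level_weight \<alpha> 0 n"
  proof (rule Lim_transform_eventually)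
    show "\<forall>\<^sub>F N in sequentially. (1 - \<alpha> / (real N)\<^sup>2) ^ (N * N) * level_weight \<alpha> (\<alpha> / (real N)\<^sup>2) n
       = (\<Sum>l\<in>parts_of n. meixner_mass N N (\<alpha> / (real N)\<^sup>2) l)"
      using eventually_ge_at_top[of "Suc n"]
    proof eventually_elim
      case (elim N)
      then show ?case
        using sum_meixner_mass[where q = "\<alpha> / (real N)\<^sup>2" and N = N and n = n] by (simp add: parts_of_upto_eq)
    qed
  qed
qed

text \<open>For \<open>L \<le> M\<close> only the first \<open>M\<close> factors can differ from 1,
  and each is bounded. The constant is taken at least 1 so that it also bounds the trivial
  factors.\<close>

lemma gen_class_bound:
  assumes "g \<in> gen_class L"
  shows "\<exists>K\<ge>1. \<forall>M\<ge>L. \<forall>l\<in>parts_upto M. norm (g l) \<le> K ^ M"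
proof -
  obtain f where f: "bounded (range f)" "\<forall>n<0. f n = 1"
    "\<And>l. l \<in> parts \<Longrightarrow> g l = (\<Prod>i. f (int (l i) + int L - int (Suc i)))"
    using assms by (auto simp: gen_class_def)
  obtain B where B: "\<And>n. norm (f n) \<le> B" using f(1) by (auto simp: bounded_iff)
  show ?thesis
  proof (intro exI[of _ "max 1 B"] conjI allI impI ballI)
    show "1 \<le> max 1 B" by simp
    fix M l assume M: "L \<le> M" "l \<in> parts_upto M"
    have "norm (g l) = (\<Prod>i<M. norm (f (int (l i) + int L - int (Suc i))))"
      using f(3)[of l] prodinf_parts_upto[OF f(2) M(2,1)] M(2) by (simp add: parts_upto_def prod_norm)
    also have "\<dots> \<le> (\<Prod>i<M. max 1 B)"
      by (intro prod_mono) (use B in \<open>auto simp: le_max_iff_disj\<close>)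
    finally show "norm (g l) \<le> max 1 B ^ M" by simp
  qed
qed

section \<open>Integrals over countable unions of finite sets\<close>

text \<open>An absolutely summable family may be summed block by block. Disjointness makes
  \<open>snd\<close> a bijection from the pairs of block index and element onto the union.\<close>

lemma count_space_UN_finite:
  fixes F :: "'a \<Rightarrow> 'b::{banach, second_countable_topology}"
  assumes disj: "disjoint_family A" and fin: "\<And>n::nat. finite (A n)"
    and summ: "summable (\<lambda>n. \<Sum>x\<in>A n. norm (F x))"
  shows "integrable (count_space (\<Union>n. A n)) F"
    and "(\<lambda>n. \<Sum>x\<in>A n. F x) sums (\<integral>x. F x \<partial>count_space (\<Union>n. A n))"
proof -
  have bij: "bij_betw snd (Sigma UNIV A) (\<Union>n. A n)"
    using disj by (auto simp: bij_betw_def inj_on_def disjoint_family_on_def image_iff)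
  have sig: "Infinite_Set_Sum.abs_summable_on (\<lambda>(n, x). F x) (Sigma UNIV A)"
    by (subst abs_summable_on_Sigma_iff)
      (use fin summ in \<open>auto simp: abs_summable_on_nat_iff' sum_nonneg countable_finite\<close>)
  then have "Infinite_Set_Sum.abs_summable_on F (\<Union>n. A n)"
    using abs_summable_on_reindex_bij_betw[OF bij, of F] by (simp add: case_prod_unfold)
  then show "integrable (count_space (\<Union>n. A n)) F" by (simp add: abs_summable_on_def)
  have eq: "(\<lambda>n. \<Sum>x\<in>A n. F x) = (\<lambda>n. infsetsum F (A n))" using fin by simp
  have "Infinite_Set_Sum.abs_summable_on (\<lambda>n. infsetsum F (A n)) UNIV"
    using abs_summable_on_Sigma_project1'[OF sig] fin by (simp add: countable_finite)
  then have "(\<lambda>n. infsetsum F (A n)) sums infsetsum (\<lambda>n. infsetsum F (A n)) UNIV"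
    by (rule sums_infsetsum_nat')
  also have "infsetsum (\<lambda>n. infsetsum F (A n)) UNIV = infsetsum (\<lambda>(n, x). F x) (Sigma UNIV A)"
    by (rule infsetsum_Sigma') (use sig fin in \<open>auto simp: countable_finite\<close>)
  also have "\<dots> = infsetsum F (\<Union>n. A n)"
    using infsetsum_reindex_bij_betw[OF bij, of F] by (simp add: case_prod_unfold)
  finally show "(\<lambda>n. \<Sum>x\<in>A n. F x) sums (\<integral>x. F x \<partial>count_space (\<Union>n. A n))"
    unfolding eq by (simp add: infsetsum_def)
qed

text \<open>The weight is a density with respect to counting measure and moves into the
  integrand.\<close>

lemma point_measure_UN_finite:
  fixes F :: "'a \<Rightarrow> 'b::{banach, second_countable_topology}"
  assumes disj: "disjoint_family A" and fin: "\<And>n::nat. finite (A n)"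
    and nonneg: "\<And>x n. x \<in> A n \<Longrightarrow> 0 \<le> w x"
    and summ: "summable (\<lambda>n. \<Sum>x\<in>A n. w x * norm (F x))"
  shows "integrable (point_measure (\<Union>n. A n) (\<lambda>x. ennreal (w x))) F"
    and "(\<lambda>n. \<Sum>x\<in>A n. w x *\<^sub>R F x) sums (\<integral>x. F x \<partial>point_measure (\<Union>n. A n) (\<lambda>x. ennreal (w x)))"
proof -
  have "(\<Sum>x\<in>A n. norm (w x *\<^sub>R F x)) = (\<Sum>x\<in>A n. w x * norm (F x))" for n
    using nonneg by (intro sum.cong) auto
  then have "summable (\<lambda>n. \<Sum>x\<in>A n. norm (w x *\<^sub>R F x))" using summ by simp
  note * = count_space_UN_finite[OF disj fin this]
  show "integrable (point_measure (\<Union>n. A n) (\<lambda>x. ennreal (w x))) F"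
    unfolding point_measure_def
    by (subst integrable_density) (use nonneg *(1) in \<open>auto simp: AE_count_space\<close>)
  have "(\<integral>x. F x \<partial>point_measure (\<Union>n. A n) (\<lambda>x. ennreal (w x))) =
      (\<integral>x. w x *\<^sub>R F x \<partial>count_space (\<Union>n. A n))"
    unfolding point_measure_def
    by (subst integral_density) (use nonneg in \<open>auto simp: AE_count_space\<close>)
  then show "(\<lambda>n. \<Sum>x\<in>A n. w x *\<^sub>R F x) sums (\<integral>x. F x \<partial>point_measure (\<Union>n. A n) (\<lambda>x. ennreal (w x)))"
    using *(2) by simp
qed

section \<open>Convergence of the expectations by domination over the levels\<close>

theorem theorem1p1:
  fixes L :: nat and \<alpha> :: real and g :: "(nat \<Rightarrow> nat) \<Rightarrow> complex"
  assumes "\<alpha> > 0" and "g \<in> gen_class L"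
  shows "integrable (poisson_plancherel \<alpha>) g \<and>
         (\<forall>N::nat. 0 < N \<longrightarrow> L \<le> N \<longrightarrow> \<alpha> / (real N)\<^sup>2 < 1 \<longrightarrow>
            integrable (meixner N N (\<alpha> / (real N)\<^sup>2)) g) \<and>
         (\<lambda>N::nat. integral\<^sup>L (meixner N N (\<alpha> / (real N)\<^sup>2)) g)
           \<longlonglongrightarrow> integral\<^sup>L (poisson_plancherel \<alpha>) g"
proof -
  obtain K where K: "1 \<le> K" and g: "\<And>M l. L \<le> M \<Longrightarrow> l \<in> parts_upto M \<Longrightarrow> norm (g l) \<le> K ^ M"
    using gen_class_bound[OF assms(2)] by blast
  define q where "q N = \<alpha> / (real N)\<^sup>2" for N :: nat
  define P where "P = poisson_plancherel_mass \<alpha>"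
  define m where "m N = meixner_mass N N (q N)" for N
  have q0: "0 \<le> q N" for N using assms(1) by (simp add: q_def)
  have P0: "0 \<le> P l" if "l \<in> parts_of n" for l n
    using that assms(1) poisson_plancherel_mass_nonneg[of l \<alpha>] by (auto simp: P_def parts_of_def)
  have m0: "0 \<le> m N l" if "q N < 1" "l \<in> parts_of_upto N n" for l n N
    using that q0[of N] meixner_mass_nonneg[of l N "q N"] by (auto simp: m_def parts_of_upto_def)
  \<comment> \<open>Taking \<open>M = L + n\<close> in \<open>g\<close> provides at least
    \<open>L\<close> rows and enough rows for a partition of \<open>n\<close>; the bound does not
    involve \<open>N\<close>.\<close>
  have gn: "norm (g l) \<le> K ^ (L + n)" if "l \<in> parts_of n" for l n
    using that subsetD[OF parts_of_subset_upto that] by (intro g) (auto simp: parts_upto_iff)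
  \<comment> \<open>The normalizing constant is at most 1 and is dropped.\<close>
  have sum_m: "(\<Sum>l\<in>parts_of_upto N n. m N l) \<le> level_weight \<alpha> (q N) n" if "0 < N" "q N < 1" for N n
  proof -
    have "(1 - q N) ^ (N * N) * level_weight \<alpha> (q N) n \<le> 1 * level_weight \<alpha> (q N) n"
      by (intro mult_right_mono power_le_one level_weight_nonneg) (use that q0[of N] assms(1) in auto)
    moreover have "q N * (real N)\<^sup>2 = \<alpha>" using that by (simp add: q_def)
    ultimately show ?thesis using sum_meixner_mass[where q = "q N" and N = N and n = n] by (simp add: m_def)
  qed
  have P_bound: "(\<Sum>l\<in>parts_of n. P l * norm (g l)) \<le> K ^ L * exp (- \<alpha>) * level_weight (K * \<alpha>) 0 n" for n
  proof -
    have "(\<Sum>l\<in>parts_of n. P l * norm (g l)) \<le> (\<Sum>l\<in>parts_of n. P l * K ^ (L + n))"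
      using P0 gn by (intro sum_mono mult_left_mono) auto
    also have "\<dots> = K ^ L * exp (- \<alpha>) * (K ^ n * level_weight \<alpha> 0 n)"
      by (simp add: sum_distrib_right[symmetric] P_def sum_poisson_plancherel_mass power_add)
    finally show ?thesis by (simp add: level_weight_scale)
  qed
  \<comment> \<open>The bound \<open>C\<close> stays open: \<open>K ^ N\<close> serves integrability
    for fixed \<open>N\<close>, and \<open>K ^ (L + n)\<close> the domination uniform in
    \<open>N\<close>.\<close>
  have m_bound: "(\<Sum>l\<in>parts_of_upto N n. m N l * norm (g l)) \<le> C * level_weight \<alpha> (q N) n"
    if "0 < N" "q N < 1" "\<And>l. l \<in> parts_of_upto N n \<Longrightarrow> norm (g l) \<le> C" "0 \<le> C" for N n C
  proof -
    have "(\<Sum>l\<in>parts_of_upto N n. m N l * norm (g l)) \<le> (\<Sum>l\<in>parts_of_upto N n. m N l * C)"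
      using that m0 by (intro sum_mono mult_left_mono) auto
    also have "\<dots> \<le> level_weight \<alpha> (q N) n * C"
      unfolding sum_distrib_right[symmetric] using sum_m that by (intro mult_right_mono) auto
    finally show ?thesis by (simp add: mult.commute)
  qed
  have "summable (\<lambda>n. \<Sum>l\<in>parts_of n. P l * norm (g l))"
  proof (rule summable_comparison_test')
    show "summable (\<lambda>n. K ^ L * exp (- \<alpha>) * level_weight (K * \<alpha>) 0 n)"
      by (intro summable_mult summable_level_weight) (use K assms(1) in auto)
    fix n show "norm (\<Sum>l\<in>parts_of n. P l * norm (g l)) \<le> K ^ L * exp (- \<alpha>) * level_weight (K * \<alpha>) 0 n"
      using P_bound P0 by (simp add: sum_nonneg)
  qed
  note P_int = point_measure_UN_finite[OF disjoint_parts_of finite_parts_of P0 this,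
      unfolded UN_parts_of, folded poisson_plancherel_def[of \<alpha>, folded P_def]]
  have m_int: "integrable (meixner N N (q N)) g"
    "(\<lambda>n. \<Sum>l\<in>parts_of_upto N n. m N l *\<^sub>R g l) sums (\<integral>l. g l \<partial>meixner N N (q N))"
    if N: "0 < N" "L \<le> N" "q N < 1" for N
  proof -
    \<comment> \<open>For fixed \<open>N\<close> the bound \<open>K ^ N\<close> is constant in
      \<open>n\<close>, so \<open>q N < 1\<close> is enough and \<open>K * q N < 1\<close> need not
      hold.\<close>
    have summ: "summable (\<lambda>n. \<Sum>l\<in>parts_of_upto N n. m N l * norm (g l))"
    proof (rule summable_comparison_test')
      show "summable (\<lambda>n. K ^ N * level_weight \<alpha> (q N) n)"
        by (intro summable_mult summable_level_weight) (use N q0 assms(1) in auto)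
      fix n
      have "(\<Sum>l\<in>parts_of_upto N n. m N l * norm (g l)) \<le> K ^ N * level_weight \<alpha> (q N) n"
        using N K g[OF N(2)] by (intro m_bound) (auto simp: parts_of_upto_def)
      then show "norm (\<Sum>l\<in>parts_of_upto N n. m N l * norm (g l)) \<le> K ^ N * level_weight \<alpha> (q N) n"
        using m0[OF N(3)] by (simp add: sum_nonneg)
    qed
    have eq: "meixner N N (q N) = point_measure (\<Union>n. parts_of_upto N n) (\<lambda>l. ennreal (m N l))"
      by (simp add: meixner_def UN_parts_of_upto m_def)
    show "integrable (meixner N N (q N)) g"
      "(\<lambda>n. \<Sum>l\<in>parts_of_upto N n. m N l *\<^sub>R g l) sums (\<integral>l. g l \<partial>meixner N N (q N))"
      using point_measure_UN_finite[OF disjoint_parts_of_upto finite_parts_of_upto m0[OF N(3)] summ]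
      unfolding eq by auto
  qed
  \<comment> \<open>From \<open>N0\<close> on, the decay rate \<open>q N\<close> of the levels beats
    the growth rate \<open>K\<close> of \<open>g\<close>, so the dominating series
    converges.\<close>
  obtain N0 :: nat where N0: "0 < N0" "L \<le> N0" "K * q N0 < 1"
  proof -
    have "(\<lambda>N. K * (\<alpha> / real N * (1 / real N))) \<longlonglongrightarrow> K * (0 * 0)"
      by (intro tendsto_intros lim_const_over_n)
    then have "\<forall>\<^sub>F N in sequentially. K * q N < 1"
      by (intro order_tendstoD(2)[of _ 0]) (simp_all add: q_def power2_eq_square)
    then have "\<forall>\<^sub>F N in sequentially. 0 < N \<and> L \<le> N \<and> K * q N < 1"
      using eventually_gt_at_top[of 0] eventually_ge_at_top[of L] by eventually_elim auto
    then show ?thesis using that by (auto simp: eventually_sequentially)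
  qed
  have q_le: "q N \<le> q N0" if "N0 \<le> N" for N
    unfolding q_def using that N0 assms(1) by (intro divide_left_mono power_mono) auto
  have qN0: "q N0 < 1"
    using mult_right_mono[OF K q0[of N0]] N0(3) by simp
  let ?a = "\<lambda>n N. \<Sum>l\<in>parts_of_upto N n. m N l *\<^sub>R g l"
  have "(\<lambda>N. \<Sum>n. ?a n N) \<longlonglongrightarrow> (\<Sum>n. \<Sum>l\<in>parts_of n. P l *\<^sub>R g l)"
  proof (rule tannerys_theorem[THEN conjunct2, THEN conjunct2])
    fix n
    have "(\<lambda>N. \<Sum>l\<in>parts_of n. m N l *\<^sub>R g l) \<longlonglongrightarrow> (\<Sum>l\<in>parts_of n. P l *\<^sub>R g l)"
      unfolding m_def q_def P_def by (intro tendsto_intros meixner_mass_tendsto)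
    \<comment> \<open>Once \<open>n \<le> N\<close>, the level consists of all partitions of
      \<open>n\<close>, and only the masses vary with \<open>N\<close>.\<close>
    then show "?a n \<longlonglongrightarrow> (\<Sum>l\<in>parts_of n. P l *\<^sub>R g l)"
      by (rule Lim_transform_eventually)
        (use eventually_ge_at_top[of n] in \<open>eventually_elim, simp add: parts_of_upto_eq\<close>)
  next
    show "summable (\<lambda>n. K ^ L * level_weight (K * \<alpha>) (K * q N0) n)"
      by (intro summable_mult summable_level_weight) (use K q0 N0 assms(1) in auto)
    \<comment> \<open>As \<open>q N\<close> decreases in \<open>N\<close>, passing to
      \<open>q N0\<close> makes the majorant independent of \<open>N\<close>.\<close>
    have bound: "norm (?a n N) \<le> K ^ L * level_weight (K * \<alpha>) (K * q N0) n" if N: "N0 \<le> N" for n N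
    proof -
      have qN: "q N < 1" using q_le[OF N] qN0 by simp
      have "norm (?a n N) \<le> (\<Sum>l\<in>parts_of_upto N n. norm (m N l *\<^sub>R g l))" by (rule norm_sum)
      also have "\<dots> = (\<Sum>l\<in>parts_of_upto N n. m N l * norm (g l))"
        using m0[OF qN] by (intro sum.cong) auto
      also have "\<dots> \<le> K ^ (L + n) * level_weight \<alpha> (q N) n"
        using N N0 qN K gn by (intro m_bound) (auto simp: parts_of_upto_def)
      also have "\<dots> \<le> K ^ (L + n) * level_weight \<alpha> (q N0) n"
        using K q0 assms(1) q_le[OF N] by (intro mult_left_mono level_weight_mono) auto
      also have "\<dots> = K ^ L * level_weight (K * \<alpha>) (K * q N0) n"
        by (simp add: power_add level_weight_scale[symmetric])
      finally show ?thesis .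
    qed
    \<comment> \<open>The bound holds for every \<open>n\<close>, so only the coordinate
      \<open>N\<close> has to be large.\<close>
    have "\<forall>\<^sub>F x in at_top \<times>\<^sub>F sequentially. True \<and> N0 \<le> snd x"
      by (rule eventually_prodI[OF eventually_True eventually_ge_at_top])
    then show "\<forall>\<^sub>F (n, N) in at_top \<times>\<^sub>F sequentially.
        norm (?a n N) \<le> K ^ L * level_weight (K * \<alpha>) (K * q N0) n"
      by (rule eventually_mono) (use bound in auto)
  qed simp
  also have "(\<Sum>n. \<Sum>l\<in>parts_of n. P l *\<^sub>R g l) = integral\<^sup>L (poisson_plancherel \<alpha>) g"
    using P_int(2) by (simp add: sums_iff)
  finally have "(\<lambda>N. integral\<^sup>L (meixner N N (q N)) g) \<longlonglongrightarrow> integral\<^sup>L (poisson_plancherel \<alpha>) g"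
  proof (rule Lim_transform_eventually)
    show "\<forall>\<^sub>F N in sequentially. (\<Sum>n. ?a n N) = integral\<^sup>L (meixner N N (q N)) g"
      using eventually_ge_at_top[of N0]
    proof eventually_elim
      case (elim N)
      then have "0 < N" "L \<le> N" "q N < 1" using N0 q_le[OF elim] qN0 by auto
      then show ?case using m_int(2)[of N] by (simp add: sums_iff)
    qed
  qed
  then show ?thesis using P_int(1) m_int(1) by (simp add: q_def)
qed

end
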